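(* Let $n$ be a positive integer. The space $(\Delta(\ell^1(\mathbb{Z}_n),\star_c),\tau^* )$ is homeomorphic to $\mathbb{Z}_{\lceil\frac{n+1}{2}\rceil}$, where $x\mapsto\lceil x\rceil$ is the ceiling function.
   Context: $\mathbb{Z}_n$ is the cyclic group of order $n$ (written additively), and $\mathbb{Z}_{\lceil\frac{n+1}{2}\rceil}$, which has $\lceil\frac{n+1}{2}\rceil$ elements, carries the discrete topology. $\ell^1(\mathbb{Z}_n)$ is the space of all functions $\mathbb{Z}_n\to\mathbb{C}$ with the $\ell^1$-norm. The cosine convolution of $f,g\in\ell^1(\mathbb{Z}_n)$ is $$f\star_c g(k) := \sum_{l\in\mathbb{Z}_n} f(l)\cdot\frac{g(k+l)+g(k-l)}{2},$$ which makes $\ell^1(\mathbb{Z}_n)$ a (not necessarily commutative) Banach algebra. $\Delta(\ell^1(\mathbb{Z}_n),\star_c)$ denotes the set of all nonzero continuous $\mathbb{C}$-linear maps $m:\ell^1(\mathbb{Z}_n)\to\mathbb{C}$ which are multiplicative: $m(f\star_c g)=m(f)m(g)$ for all $f,g\in\ell^1(\mathbb{Z}_n)$. $\tau^*$ is the weak* topology on it (as a subset of the dual of $\ell^1(\mathbb{Z}_n)$). *)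

theory Defs
  imports "HOL-Analysis.Analysis" "HOL-Algebra.Elementary_Groups"
begin

abbreviation Zn :: "nat \<Rightarrow> int monoid"
  where "Zn \<equiv> integer_mod_group"

text \<open>
  The index \<^term>\<open>n\<close> is assumed positive throughout; for \<^prop>\<open>n = 0\<close> the library group
  \<^term>\<open>Zn 0\<close> is the infinite group of integers.  A function on \<^term>\<open>Zn n\<close>, and likewise a
  functional on \<open>ell1 n\<close>, is represented by the HOL function that is
  \<^term>\<open>undefined\<close> outside its domain, so that equality of representatives is equality on
  the domain.
\<close>

definition ell1 :: "nat \<Rightarrow> (int \<Rightarrow> complex) set"
  where "ell1 n = carrier (Zn n) \<rightarrow>\<^sub>E UNIV"

definition ell1_add :: "nat \<Rightarrow> (int \<Rightarrow> complex) \<Rightarrow> (int \<Rightarrow> complex) \<Rightarrow> (int \<Rightarrow> complex)"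
  where "ell1_add n f g = (\<lambda>k\<in>carrier (Zn n). f k + g k)"

definition ell1_scale :: "nat \<Rightarrow> complex \<Rightarrow> (int \<Rightarrow> complex) \<Rightarrow> (int \<Rightarrow> complex)"
  where "ell1_scale n c f = (\<lambda>k\<in>carrier (Zn n). c * f k)"

definition ell1_norm :: "nat \<Rightarrow> (int \<Rightarrow> complex) \<Rightarrow> real"
  where "ell1_norm n f = (\<Sum>k\<in>carrier (Zn n). norm (f k))"

definition ell1_dist :: "nat \<Rightarrow> (int \<Rightarrow> complex) \<Rightarrow> (int \<Rightarrow> complex) \<Rightarrow> real"
  where "ell1_dist n f g = ell1_norm n (\<lambda>k\<in>carrier (Zn n). f k - g k)"

text \<open>Outside the locale \<^locale>\<open>Metric_space\<close>, \<open>Metric_space.mtopology\<close> is only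
  meaningful for an actual metric.\<close>

lemma Metric_space_ell1:
  assumes "n > 0"
  shows "Metric_space (ell1 n) (ell1_dist n)"
proof
  have fin: "finite (carrier (Zn n))"
    using assms by (simp add: carrier_integer_mod_group)
  fix f g h :: "int \<Rightarrow> complex"
  show "0 \<le> ell1_dist n f g"
    by (simp add: ell1_dist_def ell1_norm_def sum_nonneg)
  show "ell1_dist n f g = ell1_dist n g f"
    by (simp add: ell1_dist_def ell1_norm_def norm_minus_commute)
  show "ell1_dist n f g = 0 \<longleftrightarrow> f = g" if "f \<in> ell1 n" "g \<in> ell1 n"
    using that fin
    by (auto simp: ell1_dist_def ell1_norm_def ell1_def sum_nonneg_eq_0_iff intro: PiE_ext)
  show "ell1_dist n f h \<le> ell1_dist n f g + ell1_dist n g h"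
    unfolding ell1_dist_def ell1_norm_def sum.distrib[symmetric]
    by (rule sum_mono) (simp add: norm_diff_triangle_ineq, metis diff_add_cancel
        add_diff_eq norm_triangle_ineq)
qed

definition ell1_topology :: "nat \<Rightarrow> (int \<Rightarrow> complex) topology"
  where "ell1_topology n = Metric_space.mtopology (ell1 n) (ell1_dist n)"

definition cos_conv :: "nat \<Rightarrow> (int \<Rightarrow> complex) \<Rightarrow> (int \<Rightarrow> complex) \<Rightarrow> (int \<Rightarrow> complex)"
  where "cos_conv n f g =
    (\<lambda>k\<in>carrier (Zn n). \<Sum>l\<in>carrier (Zn n).
       f l * ((g (k \<otimes>\<^bsub>Zn n\<^esub> l) + g (k \<otimes>\<^bsub>Zn n\<^esub> inv\<^bsub>Zn n\<^esub> l)) / 2))"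

definition ell1_dual :: "nat \<Rightarrow> ((int \<Rightarrow> complex) \<Rightarrow> complex) set"
  where "ell1_dual n = {m \<in> ell1 n \<rightarrow>\<^sub>E UNIV.
    (\<forall>f\<in>ell1 n. \<forall>g\<in>ell1 n. m (ell1_add n f g) = m f + m g) \<and>
    (\<forall>c. \<forall>f\<in>ell1 n. m (ell1_scale n c f) = c * m f) \<and>
    continuous_map (ell1_topology n) euclidean m}"

text \<open>The coarsest topology on the dual for which all evaluations are continuous.\<close>

definition weak_star_topology :: "nat \<Rightarrow> ((int \<Rightarrow> complex) \<Rightarrow> complex) topology"
  where "weak_star_topology n =
    topology_generated_by {{m \<in> ell1_dual n. m f \<in> U} | f U. f \<in> ell1 n \<and> open U}"

definition cos_structure_space :: "nat \<Rightarrow> ((int \<Rightarrow> complex) \<Rightarrow> complex) set"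
  where "cos_structure_space n = {m \<in> ell1_dual n.
    (\<exists>f\<in>ell1 n. m f \<noteq> 0) \<and>
    (\<forall>f\<in>ell1 n. \<forall>g\<in>ell1 n. m (cos_conv n f g) = m f * m g)}"

end

theory Submission
  imports Defs
begin

text \<open>
  Since \<open>\<int>\<^sub>n\<close> is finite, a linear functional \<open>m\<close> on \<open>ell1 n\<close> is a weighted sum
  \<open>f \<mapsto> (\<Sum>k. f k * a k)\<close> with weights \<open>a k = m \<delta>\<^sub>k\<close>, and continuity is automatic.  As
  \<open>\<delta>\<^sub>i \<star> \<delta>\<^sub>j = (\<delta>\<^sub>j\<^sub>-\<^sub>i + \<delta>\<^sub>j\<^sub>+\<^sub>i) / 2\<close>, the functional is multiplicative iff \<open>a\<close> satisfies
  d'Alembert's equation \<open>a i * a j = (a (j - i) + a (j + i)) / 2\<close>, and then it is nonzero iff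
  \<open>a 0 = 1\<close>.

  Taking \<open>i = 1\<close> (\<open>structure_space_unit_vec\<close>) turns d'Alembert's equation into a three-term recursion, so
  \<open>a k = cos (k * w)\<close> for any \<open>w\<close> with \<open>cos w = a 1\<close>.  Periodicity forces
  \<open>cos (n * w) = 1\<close>, so \<open>w\<close> is a multiple of \<open>2 * \<pi> / n\<close> and \<open>a 1 = cos (2 * \<pi> * j / n)\<close>;
  by the symmetry \<open>j \<mapsto> n - j\<close> one may take \<open>j \<in> {0, ..., n div 2}\<close>.  All these values occur,
  and they are distinct because the cosine is injective on \<open>[0, \<pi>]\<close>.  Hence
  the evaluation at \<open>\<delta>\<^sub>1\<close> is a bijection from the structure space onto a set of
  \<open>n div 2 + 1 = \<lceil>(n + 1) / 2\<rceil>\<close> complex numbers (\<open>bij_betw_eval_unit_1\<close>).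

  This evaluation is weak* continuous and injective, so the structure space is Hausdorff.  Being
  finite it is discrete, and a discrete space is determined by its cardinality.
\<close>

section \<open>Functionals as weighted sums\<close>

text \<open>The index is reduced modulo \<^term>\<open>n\<close>, so that unit vectors are available for all integers
  and d'Alembert's equation can be stated without case distinctions.\<close>

definition unit_vec :: "nat \<Rightarrow> int \<Rightarrow> int \<Rightarrow> complex"
  where "unit_vec n i = (\<lambda>k\<in>carrier (Zn n). of_bool (k = i mod int n))"

definition weighted_sum :: "nat \<Rightarrow> (int \<Rightarrow> complex) \<Rightarrow> (int \<Rightarrow> complex) \<Rightarrow> complex"
  where "weighted_sum n a = (\<lambda>f\<in>ell1 n. \<Sum>k\<in>carrier (Zn n). f k * a k)"

lemma weighted_sum_apply:
  "f \<in> ell1 n \<Longrightarrow> weighted_sum n a f = (\<Sum>k\<in>carrier (Zn n). f k * a k)"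
  by (simp add: weighted_sum_def)

lemma unit_vec_in_ell1 [simp]: "unit_vec n i \<in> ell1 n"
  by (simp add: unit_vec_def ell1_def)

lemma unit_vec_mod [simp]: "unit_vec n (i mod int n) = unit_vec n i"
  by (simp add: unit_vec_def)

lemma ell1_scale_in_ell1 [simp]: "ell1_scale n c f \<in> ell1 n"
  by (simp add: ell1_scale_def ell1_def)

lemma ell1_add_in_ell1 [simp]: "ell1_add n f g \<in> ell1 n"
  by (simp add: ell1_add_def ell1_def)

lemma cos_conv_in_ell1 [simp]: "cos_conv n f g \<in> ell1 n"
  by (simp add: cos_conv_def ell1_def)

lemma dual_add:
  "m \<in> ell1_dual n \<Longrightarrow> f \<in> ell1 n \<Longrightarrow> g \<in> ell1 n \<Longrightarrow> m (ell1_add n f g) = m f + m g"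
  by (simp add: ell1_dual_def)

lemma dual_scale:
  "m \<in> ell1_dual n \<Longrightarrow> f \<in> ell1 n \<Longrightarrow> m (ell1_scale n c f) = c * m f"
  by (simp add: ell1_dual_def)

lemma structure_space_dual: "m \<in> cos_structure_space n \<Longrightarrow> m \<in> ell1_dual n"
  by (simp add: cos_structure_space_def)

lemma structure_space_mult:
  "m \<in> cos_structure_space n \<Longrightarrow> f \<in> ell1 n \<Longrightarrow> g \<in> ell1 n \<Longrightarrow> m (cos_conv n f g) = m f * m g"
  by (simp add: cos_structure_space_def)

context
  fixes n :: nat
  assumes n: "n > 0"
begin

lemma carrier_Zn: "carrier (Zn n) = {0..<int n}"
  using n by (simp add: carrier_integer_mod_group)

lemma weighted_sum_unit_vec: "weighted_sum n a (unit_vec n i) = a (i mod int n)"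
proof -
  have "weighted_sum n a (unit_vec n i) = (\<Sum>k\<in>{0..<int n}. if k = i mod int n then a k else 0)"
    by (subst weighted_sum_apply[OF unit_vec_in_ell1])
      (auto simp: unit_vec_def carrier_Zn intro!: sum.cong)
  then show ?thesis
    using n by (simp add: sum.delta)
qed

text \<open>The function \<open>f\<close> is assembled from multiples of unit vectors by induction on the finite set
  of indices covered so far.\<close>

lemma dual_eq_weighted_sum:
  assumes m: "m \<in> ell1_dual n"
  shows "m = weighted_sum n (\<lambda>k. m (unit_vec n k))"
proof -
  have partial: "m (\<lambda>k\<in>carrier (Zn n). if k \<in> S then f k else 0)
      = (\<Sum>k\<in>S. f k * m (unit_vec n k))"
    if f: "f \<in> ell1 n" and S: "finite S" "S \<subseteq> carrier (Zn n)" for f S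
    using S
  proof (induction S)
    case empty
    have "(\<lambda>k\<in>carrier (Zn n). 0) = ell1_scale n 0 f"
      by (simp add: ell1_scale_def)
    then show ?case
      using dual_scale[OF m f, of 0] by simp
  next
    case (insert i S)
    let ?g = "\<lambda>k\<in>carrier (Zn n). if k \<in> S then f k else 0"
    have "i mod int n = i"
      using insert.prems by (simp add: carrier_Zn)
    then have eq: "(\<lambda>k\<in>carrier (Zn n). if k \<in> insert i S then f k else 0)
        = ell1_add n (ell1_scale n (f i) (unit_vec n i)) ?g"
      using insert.hyps by (auto simp: ell1_add_def ell1_scale_def unit_vec_def fun_eq_iff)
    have "?g \<in> ell1 n"
      by (simp add: ell1_def)
    then have "m (ell1_add n (ell1_scale n (f i) (unit_vec n i)) ?g)
        = f i * m (unit_vec n i) + m ?g"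
      by (subst dual_add[OF m])
        (simp_all only: dual_scale[OF m] unit_vec_in_ell1 ell1_scale_in_ell1)
    moreover have "m ?g = (\<Sum>k\<in>S. f k * m (unit_vec n k))"
      using insert.prems by (intro insert.IH) simp
    ultimately show ?case
      unfolding eq using insert.hyps by simp
  qed
  show ?thesis
  proof (rule extensionalityI)
    show "m \<in> extensional (ell1 n)"
      using m by (simp add: ell1_dual_def PiE_def)
    show "weighted_sum n (\<lambda>k. m (unit_vec n k)) \<in> extensional (ell1 n)"
      by (simp add: weighted_sum_def)
    fix f assume f: "f \<in> ell1 n"
    then have "f = (\<lambda>k\<in>carrier (Zn n). if k \<in> carrier (Zn n) then f k else 0)"
      by (auto simp: ell1_def PiE_def fun_eq_iff extensional_def)
    then have "m f = m (\<lambda>k\<in>carrier (Zn n). if k \<in> carrier (Zn n) then f k else 0)"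
      by simp
    also have "\<dots> = (\<Sum>k\<in>carrier (Zn n). f k * m (unit_vec n k))"
      by (rule partial[OF f]) (simp_all add: carrier_Zn)
    finally show "m f = weighted_sum n (\<lambda>k. m (unit_vec n k)) f"
      using f by (simp add: weighted_sum_def)
  qed
qed

text \<open>The bound, which cosine weights satisfy, makes the functional 1-Lipschitz; this yields the
  continuity required in the dual.\<close>

lemma weighted_sum_in_dual:
  assumes "\<And>k. norm (a k) \<le> 1"
  shows "weighted_sum n a \<in> ell1_dual n"
proof -
  interpret Metric_space "ell1 n" "ell1_dist n"
    by (rule Metric_space_ell1[OF n])
  have "dist (weighted_sum n a f) (weighted_sum n a g) \<le> ell1_dist n f g"
    if "f \<in> ell1 n" "g \<in> ell1 n" for f g
  proof -
    have "dist (weighted_sum n a f) (weighted_sum n a g)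
        = norm (\<Sum>k\<in>carrier (Zn n). (f k - g k) * a k)"
      using that by (simp add: weighted_sum_def dist_norm sum_subtractf left_diff_distrib)
    also have "\<dots> \<le> (\<Sum>k\<in>carrier (Zn n). norm (f k - g k))"
      by (rule sum_norm_le) (simp add: norm_mult mult_left_le assms)
    finally show ?thesis
      by (simp add: ell1_dist_def ell1_norm_def)
  qed
  then have "\<exists>\<delta>>0. \<forall>g. g \<in> ell1 n \<and> ell1_dist n f g < \<delta> \<longrightarrow>
      dist (weighted_sum n a f) (weighted_sum n a g) < e"
    if "f \<in> ell1 n" "e > 0" for f e
    using that by (intro exI[of _ e]) (auto intro: le_less_trans)
  then have "continuous_map mtopology Met_TC.mtopology (weighted_sum n a)"
    by (subst metric_continuous_map[OF Met_TC.Metric_space_axioms]) auto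
  moreover have "weighted_sum n a (ell1_add n f g) = weighted_sum n a f + weighted_sum n a g"
    if "f \<in> ell1 n" "g \<in> ell1 n" for f g
    using that by (simp add: weighted_sum_apply)
      (simp add: ell1_add_def sum.distrib[symmetric] distrib_right)
  moreover have "weighted_sum n a (ell1_scale n c f) = c * weighted_sum n a f"
    if "f \<in> ell1 n" for c f
    using that by (simp add: weighted_sum_apply)
      (simp add: ell1_scale_def sum_distrib_left mult.assoc)
  moreover have "weighted_sum n a \<in> ell1 n \<rightarrow>\<^sub>E UNIV"
    by (simp add: weighted_sum_def)
  ultimately show ?thesis
    by (simp add: ell1_dual_def ell1_topology_def)
qed

section \<open>Multiplicativity and d'Alembert's equation\<close>

lemma cos_conv_apply:
  assumes "k \<in> carrier (Zn n)"
  shows "cos_conv n f g k =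
    (\<Sum>l\<in>carrier (Zn n). f l * ((g ((k + l) mod int n) + g ((k - l) mod int n)) / 2))"
  using assms by (simp add: cos_conv_def mod_add_right_eq)

lemma cos_conv_unit_vec:
  "cos_conv n (unit_vec n i) (unit_vec n j) =
    ell1_scale n (1/2) (ell1_add n (unit_vec n (j - i)) (unit_vec n (j + i)))"
proof (rule extensionalityI[where A = "carrier (Zn n)"])
  fix k assume k: "k \<in> carrier (Zn n)"
  let ?r = "i mod int n"
  have r: "?r \<in> {0..<int n}"
    using n by simp
  have "cos_conv n (unit_vec n i) (unit_vec n j) k =
      (\<Sum>l\<in>{0..<int n}. if l = ?r then (unit_vec n j ((k + l) mod int n)
        + unit_vec n j ((k - l) mod int n)) / 2 else 0)"
    unfolding cos_conv_apply[OF k] carrier_Zn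
    by (rule sum.cong) (auto simp: unit_vec_def carrier_Zn)
  also have "\<dots> = (unit_vec n j ((k + i) mod int n) + unit_vec n j ((k - i) mod int n)) / 2"
    using r by (simp add: sum.delta mod_simps)
  also have "\<dots> = (unit_vec n (j - i) k + unit_vec n (j + i) k) / 2"
  proof -
    have "(k + i) mod int n = j mod int n \<longleftrightarrow> k mod int n = (j - i) mod int n"
      "(k - i) mod int n = j mod int n \<longleftrightarrow> k mod int n = (j + i) mod int n"
      by (simp_all add: mod_eq_dvd_iff algebra_simps)
    moreover have "k mod int n = k"
      using k by (simp add: carrier_Zn)
    ultimately show ?thesis
      using k n by (simp add: unit_vec_def carrier_Zn)
  qed
  finally show "cos_conv n (unit_vec n i) (unit_vec n j) k =
      ell1_scale n (1/2) (ell1_add n (unit_vec n (j - i)) (unit_vec n (j + i))) k"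
    using k by (simp add: ell1_scale_def ell1_add_def)
qed (simp_all add: cos_conv_def ell1_scale_def)

text \<open>Translation invariance of the counting measure on \<open>\<int>\<^sub>n\<close>.\<close>

lemma sum_carrier_shift:
  fixes h :: "int \<Rightarrow> complex"
  shows "(\<Sum>k\<in>carrier (Zn n). h ((k + l) mod int n)) = (\<Sum>k\<in>carrier (Zn n). h k)"
proof (rule sum.reindex_bij_witness[where i = "\<lambda>k. (k - l) mod int n"
      and j = "\<lambda>k. (k + l) mod int n"])
  fix k assume "k \<in> carrier (Zn n)"
  then have "k mod int n = k"
    by (simp add: carrier_Zn)
  then show "((k + l) mod int n - l) mod int n = k" "((k - l) mod int n + l) mod int n = k"
    by (simp_all add: mod_diff_left_eq mod_add_left_eq)
qed (use n in \<open>simp_all add: carrier_Zn\<close>)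

text \<open>The multiplicativity on unit vectors extends to all functions; translation invariance
  turns the two translates of \<open>g\<close> into the two terms of d'Alembert's equation.\<close>

lemma weighted_sum_mult:
  assumes per: "\<And>k. a (k mod int n) = a k"
    and dAlembert: "\<And>i j. a i * a j = (a (j - i) + a (j + i)) / 2"
    and f: "f \<in> ell1 n" and g: "g \<in> ell1 n"
  shows "weighted_sum n a (cos_conv n f g) = weighted_sum n a f * weighted_sum n a g"
proof -
  let ?C = "carrier (Zn n)"
  have shift: "(\<Sum>k\<in>?C. g ((k + l) mod int n) * a k) = (\<Sum>k\<in>?C. g k * a (k - l))" for l
  proof -
    have "a (((k + l) mod int n) - l) = a k" for k
      by (metis add_diff_cancel_right' mod_diff_left_eq per)
    then show ?thesis
      using sum_carrier_shift[of "\<lambda>k. g k * a (k - l)" l] by simp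
  qed
  have "weighted_sum n a (cos_conv n f g) = (\<Sum>k\<in>?C. \<Sum>l\<in>?C.
      f l * ((g ((k + l) mod int n) + g ((k - l) mod int n)) / 2) * a k)"
    by (simp add: weighted_sum_def cos_conv_apply sum_distrib_right)
  also have "\<dots> = (\<Sum>l\<in>?C. \<Sum>k\<in>?C.
      f l * ((g ((k + l) mod int n) + g ((k - l) mod int n)) / 2) * a k)"
    by (rule sum.swap)
  also have "\<dots> = (\<Sum>l\<in>?C. f l / 2 * ((\<Sum>k\<in>?C. g ((k + l) mod int n) * a k)
      + (\<Sum>k\<in>?C. g ((k + (- l)) mod int n) * a k)))"
    by (simp add: sum_distrib_left sum.distrib[symmetric] algebra_simps add_divide_distrib)
  also have "\<dots> = (\<Sum>l\<in>?C. f l / 2 * (\<Sum>k\<in>?C. g k * (a (k - l) + a (k + l))))"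
    by (simp only: shift sum.distrib[symmetric] distrib_left minus_minus diff_minus_eq_add)
  also have "\<dots> = (\<Sum>l\<in>?C. f l / 2 * (\<Sum>k\<in>?C. g k * (2 * (a l * a k))))"
  proof -
    have "a (k - l) + a (k + l) = 2 * (a l * a k)" for k l
      unfolding dAlembert by simp
    then show ?thesis
      by (simp only:)
  qed
  also have "\<dots> = (\<Sum>l\<in>?C. \<Sum>k\<in>?C. (f l * a l) * (g k * a k))"
    by (simp add: sum_distrib_left mult_ac)
  also have "\<dots> = weighted_sum n a f * weighted_sum n a g"
    using f g by (simp add: weighted_sum_def sum_product)
  finally show ?thesis .
qed

section \<open>Classification of the characters\<close>

text \<open>With \<open>i = 1\<close> d'Alembert's equation is the recursion \<open>a (k + 2) = 2 * a 1 * a (k + 1) - a k\<close>,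
  which \<open>cos (k * w)\<close> satisfies too.  The angle is complex here because nothing yet shows that the
  value at \<open>\<delta>\<^sub>1\<close> is a real number in \<open>[- 1, 1]\<close>.\<close>

lemma structure_space_unit_vec:
  assumes m: "m \<in> cos_structure_space n"
  shows "m (unit_vec n (int k)) = cos (of_nat k * Arccos (m (unit_vec n 1)))"
proof -
  let ?a = "\<lambda>k. m (unit_vec n k)"
  let ?w = "Arccos (?a 1)"
  note dual = structure_space_dual[OF m]
  have dAlembert: "?a i * ?a j = (?a (j - i) + ?a (j + i)) / 2" for i j
    using structure_space_mult[OF m, of "unit_vec n i" "unit_vec n j"]
    by (simp add: cos_conv_unit_vec dual_scale[OF dual] dual_add[OF dual])
  have "\<exists>i. ?a i \<noteq> 0"
  proof (rule ccontr)
    assume "\<nexists>i. ?a i \<noteq> 0"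
    then have "m f = 0" if "f \<in> ell1 n" for f
      using that by (subst dual_eq_weighted_sum[OF dual]) (simp add: weighted_sum_def)
    then show False
      using m by (auto simp: cos_structure_space_def)
  qed
  \<comment> \<open>\<open>\<delta>\<^sub>0\<close> is a left unit, so its value can be cancelled against a nonzero weight\<close>
  then have a0: "?a 0 = 1"
    using dAlembert[of 0] by auto
  show ?thesis
  proof (induction k rule: induct_nat_012)
    case 0
    show ?case using a0 by simp
  next
    case 1
    show ?case by simp
  next
    case (ge2 k)
    let ?t = "of_nat (Suc k) * ?w"
    have "?a (int (Suc (Suc k))) = 2 * (?a 1 * ?a (int (Suc k))) - ?a (int k)"
      unfolding dAlembert by (simp add: algebra_simps)
    also have "\<dots> = 2 * (cos ?w * cos ?t) - cos (?t - ?w)"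
      using ge2 by (simp add: algebra_simps)
    also have "\<dots> = cos (?t + ?w)"
      by (simp add: cos_add cos_diff)
    finally show ?case
      by (simp add: algebra_simps)
  qed
qed

definition cos_angle :: "int \<Rightarrow> real"
  where "cos_angle j = cos (2 * pi * of_int j / of_nat n)"

lemma cos_angle_mod: "cos_angle (j mod int n) = cos_angle j"
proof -
  have "real_of_int j = of_int (j mod int n) + of_nat n * of_int (j div int n)"
    by (metis mod_mult_div_eq of_int_add of_int_mult of_int_of_nat_eq)
  then have "2 * pi * of_int j / of_nat n
      = 2 * pi * of_int (j mod int n) / of_nat n + of_int (j div int n) * (2 * pi)"
    using n by (simp add: field_simps)
  then show ?thesis
    unfolding cos_angle_def
    by (simp add: cos_add cos_int_2pin sin_int_2pin mult.commute[of _ "2 * pi"])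
qed

lemma cos_angle_minus: "cos_angle (- j) = cos_angle j"
  by (simp add: cos_angle_def)

text \<open>The reflection \<open>j \<mapsto> n - j\<close> leaves the value unchanged, so half of the residues suffices.\<close>

lemma cos_angle_fold: "\<exists>j'\<in>{0..<int (n div 2 + 1)}. cos_angle j = cos_angle j'"
proof (cases "j mod int n \<le> int (n div 2)")
  case True
  then show ?thesis
    using n by (intro bexI[of _ "j mod int n"]) (auto simp: cos_angle_mod)
next
  case False
  have "cos_angle j = cos_angle (- (j mod int n) mod int n)"
    by (simp add: cos_angle_mod cos_angle_minus)
  also have "- (j mod int n) mod int n = int n - j mod int n"
    using False n by (auto simp: zmod_zminus1_eq_if)
  finally show ?thesis
    using False n by (intro bexI[of _ "int n - j mod int n"]) (auto simp: less_imp_le)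
qed

text \<open>For these indices the angle lies in \<open>[0, \<pi>]\<close>.\<close>

lemma inj_on_cos_angle: "inj_on cos_angle {0..<int (n div 2 + 1)}"
proof (rule inj_onI)
  fix i j assume ij: "i \<in> {0..<int (n div 2 + 1)}" "j \<in> {0..<int (n div 2 + 1)}"
    and eq: "cos_angle i = cos_angle j"
  have bounds: "0 \<le> 2 * pi * of_int k / of_nat n \<and> 2 * pi * of_int k / of_nat n \<le> pi"
    if "k \<in> {0..<int (n div 2 + 1)}" for k
  proof -
    have "0 \<le> k" "2 * k \<le> int n"
      using that by auto
    then have "0 \<le> real_of_int k" "2 * real_of_int k \<le> real n"
      by linarith+
    then show ?thesis
      using n mult_left_mono[of "2 * real_of_int k" "real n" pi] by (simp add: field_simps)
  qed
  have "2 * pi * real_of_int i / real n = 2 * pi * real_of_int j / real n"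
    by (rule cos_inj_pi) (use bounds ij eq in \<open>simp_all only: cos_angle_def\<close>)
  then show "i = j"
    using n by simp
qed

text \<open>Since \<open>\<delta>\<^sub>n = \<delta>\<^sub>0\<close>, the angle \<open>w\<close> of the character satisfies \<open>cos (n * w) = 1\<close>.\<close>

lemma eval_unit_1_in_cos_angle:
  assumes m: "m \<in> cos_structure_space n"
  shows "\<exists>j\<in>{0..<int (n div 2 + 1)}. m (unit_vec n 1) = of_real (cos_angle j)"
proof -
  let ?w = "Arccos (m (unit_vec n 1))"
  have "m (unit_vec n (int n)) = m (unit_vec n (int 0))"
    by (metis mod_self mod_0 of_nat_0 unit_vec_mod)
  then have "cos (of_nat n * ?w) = 1"
    using structure_space_unit_vec[OF m, of n] structure_space_unit_vec[OF m, of 0] by simp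
  then obtain j :: int where "of_nat n * ?w = of_real (2 * of_int j * pi)"
    unfolding cos_eq_1 by blast
  then have "?w = of_real (2 * pi * of_int j / of_nat n)"
    using n by (simp add: field_simps)
  then have "m (unit_vec n 1) = of_real (cos_angle j)"
    unfolding cos_angle_def by (metis cos_Arccos cos_of_real)
  then show ?thesis
    using cos_angle_fold[of j] by auto
qed

lemma weighted_sum_cos_in_structure_space:
  "weighted_sum n (\<lambda>k. of_real (cos_angle (j * k))) \<in> cos_structure_space n" (is "?m \<in> _")
proof -
  have per: "cos_angle (j * (k mod int n)) = cos_angle (j * k)" for k
    by (metis cos_angle_mod mod_mult_right_eq)
  have "cos_angle (j * i) * cos_angle (j * k)
      = (cos_angle (j * (k - i)) + cos_angle (j * (k + i))) / 2" for i k
  proof -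
    let ?x = "2 * pi * of_int (j * i) / of_nat n" and ?y = "2 * pi * of_int (j * k) / of_nat n"
    have "cos ?x * cos ?y = (cos (?y - ?x) + cos (?y + ?x)) / 2"
      using cos_times_cos[of ?y ?x] by (simp only: mult.commute)
    moreover have "?y - ?x = 2 * pi * of_int (j * (k - i)) / of_nat n"
      "?y + ?x = 2 * pi * of_int (j * (k + i)) / of_nat n"
      by (simp_all add: diff_divide_distrib add_divide_distrib algebra_simps)
    ultimately show ?thesis
      by (simp only: cos_angle_def)
  qed
  then have "of_real (cos_angle (j * i)) * of_real (cos_angle (j * k))
      = ((of_real (cos_angle (j * (k - i))) + of_real (cos_angle (j * (k + i)))) / 2 :: complex)"
    for i k
    by (metis of_real_add of_real_divide of_real_mult of_real_numeral)
  then have "?m (cos_conv n f g) = ?m f * ?m g" if "f \<in> ell1 n" "g \<in> ell1 n" for f g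
    using that by (intro weighted_sum_mult) (auto simp: per)
  moreover have "?m (unit_vec n 0) \<noteq> 0"
    by (simp add: weighted_sum_unit_vec cos_angle_def)
  moreover have "?m \<in> ell1_dual n"
    by (rule weighted_sum_in_dual) (simp add: cos_angle_def)
  ultimately show ?thesis
    unfolding cos_structure_space_def using unit_vec_in_ell1 by blast
qed

text \<open>The value at \<open>\<delta>\<^sub>1\<close> fixes the angle, hence all weights.\<close>

lemma inj_on_eval_unit_1: "inj_on (\<lambda>m. m (unit_vec n 1)) (cos_structure_space n)"
proof (rule inj_onI)
  fix m m' assume m: "m \<in> cos_structure_space n" and m': "m' \<in> cos_structure_space n"
    and eq: "m (unit_vec n 1) = m' (unit_vec n 1)"
  have "m (unit_vec n k) = m' (unit_vec n k)" if "k \<in> carrier (Zn n)" for k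
    using that structure_space_unit_vec[OF m, of "nat k"]
      structure_space_unit_vec[OF m', of "nat k"]
    by (simp add: carrier_Zn eq)
  then have "weighted_sum n (\<lambda>k. m (unit_vec n k)) = weighted_sum n (\<lambda>k. m' (unit_vec n k))"
    by (simp add: weighted_sum_def)
  then show "m = m'"
    using dual_eq_weighted_sum structure_space_dual m m' by metis
qed

lemma bij_betw_eval_unit_1:
  "bij_betw (\<lambda>m. m (unit_vec n 1)) (cos_structure_space n)
    ((\<lambda>j. of_real (cos_angle j)) ` {0..<int (n div 2 + 1)})"
  unfolding bij_betw_def
proof (intro conjI equalityI subsetI)
  fix x :: complex assume "x \<in> (\<lambda>j. of_real (cos_angle j)) ` {0..<int (n div 2 + 1)}"
  then obtain j where j: "x = of_real (cos_angle j)"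
    by blast
  let ?m = "weighted_sum n (\<lambda>k. of_real (cos_angle (j * k)))"
  have "?m (unit_vec n 1) = of_real (cos_angle (j * (1 mod int n)))"
    by (rule weighted_sum_unit_vec)
  also have "\<dots> = x"
    unfolding j by (metis cos_angle_mod mod_mult_right_eq mult.right_neutral)
  finally show "x \<in> (\<lambda>m. m (unit_vec n 1)) ` cos_structure_space n"
    using weighted_sum_cos_in_structure_space by (metis image_eqI)
qed (use eval_unit_1_in_cos_angle inj_on_eval_unit_1 in auto)

end

section \<open>The topology\<close>

lemma topspace_weak_star: "topspace (weak_star_topology n) = ell1_dual n"
proof -
  have "ell1_dual n = {m \<in> ell1_dual n. m (unit_vec n 0) \<in> UNIV}"
    by simp
  then show ?thesis
    unfolding weak_star_topology_def topology_generated_by_topspace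
    using unit_vec_in_ell1[of n 0] open_UNIV by blast
qed

lemma continuous_map_weak_star_eval:
  assumes "f \<in> ell1 n"
  shows "continuous_map (weak_star_topology n) euclidean (\<lambda>m. m f)"
  using assms unfolding continuous_map_def topspace_weak_star
  by (auto simp: weak_star_topology_def intro!: topology_generated_by_Basis)

lemma discrete_topology_homeomorphic_space:
  assumes "bij_betw f A B"
  shows "discrete_topology A homeomorphic_space discrete_topology B"
proof -
  have "homeomorphic_map (discrete_topology A) (discrete_topology B) f"
    using assms by (auto simp: bij_betw_def homeomorphic_eq_everything_map
        open_map_into_discrete_topology closed_map_into_discrete_topology)
  then show ?thesis
    by (rule homeomorphic_map_imp_homeomorphic_space)
qed

theorem theorem14:
  fixes n :: nat
  assumes "n > 0"
  shows "subtopology (weak_star_topology n) (cos_structure_space n) homeomorphic_space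
    discrete_topology (carrier (Zn (nat \<lceil>(real n + 1) / 2\<rceil>)))"
proof -
  let ?X = "subtopology (weak_star_topology n) (cos_structure_space n)"
  let ?J = "{0..<int (n div 2 + 1)}"
  have top: "topspace ?X = cos_structure_space n"
    using structure_space_dual by (auto simp: topspace_weak_star)
  have "inj_on (\<lambda>j. of_real (cos_angle n j) :: complex) ?J"
    using inj_on_cos_angle[OF assms] by (auto simp: inj_on_def)
  then have "bij_betw (\<lambda>j. of_real (cos_angle n j)) ?J
      ((\<lambda>j. of_real (cos_angle n j) :: complex) ` ?J)"
    by (rule inj_on_imp_bij_betw)
  then obtain h where h: "bij_betw h (cos_structure_space n) ?J"
    using bij_betw_trans[OF bij_betw_eval_unit_1[OF assms] bij_betw_inv_into] by blast
  have "Hausdorff_space ?X"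
    using inj_on_eval_unit_1[OF assms] top
    by (intro Hausdorff_space_injective_preimage[of euclidean ?X "\<lambda>m. m (unit_vec n 1)"]
        continuous_map_from_subtopology continuous_map_weak_star_eval) simp_all
  moreover have "finite (cos_structure_space n)"
    using bij_betw_finite[OF h] by simp
  ultimately have "?X = discrete_topology (cos_structure_space n)"
    using top by (intro finite_topspace_imp_discrete_topology)
  moreover have "carrier (Zn (nat \<lceil>(real n + 1) / 2\<rceil>)) = ?J"
  proof -
    have "2 * (n div 2) \<le> n" "n \<le> 2 * (n div 2) + 1"
      by presburger+
    then have "2 * real (n div 2) \<le> real n" "real n \<le> 2 * real (n div 2) + 1"
      by linarith+
    then have "\<lceil>(real n + 1) / 2\<rceil> = int (n div 2 + 1)"
      by (intro ceiling_unique) (simp_all add: field_simps)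
    then show ?thesis
      by (simp add: carrier_integer_mod_group)
  qed
  ultimately show ?thesis
    using discrete_topology_homeomorphic_space[OF h] by simp
qed

end
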